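(* Let $O$ be either $\mathbb{Z}[\sqrt{-3}]$ or $\mathbb{Z}[\sqrt{-7}]$. Then every invertible ideal of $O$ is principal. *)

theory Defs
  imports "HOL-Analysis.Complex_Transcendental" "HOL-Algebra.Algebra"
    "HOL-Algebra.Algebraic_Closure_Type"
begin

abbreviation complex_ring :: "complex ring" where
  "complex_ring \<equiv> ring_of_type_algebra"

text \<open>The ring \<open>\<int>[\<surd>d]\<close>, as the smallest subring of the complex numbers containing \<open>\<surd>d\<close>.\<close>

definition Z_sqrt :: "int \<Rightarrow> complex ring" where
  "Z_sqrt d = complex_ring\<lparr>carrier := generate_ring complex_ring {csqrt (of_int d)}\<rparr>"

text \<open>
  In the following definitions \<open>R\<close> is the carrier of a subring of the field \<open>L\<close>, and the
  field of fractions of \<open>R\<close> is formed inside \<open>L\<close>.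
\<close>

definition fractions :: "('a, 'b) ring_scheme \<Rightarrow> 'a set \<Rightarrow> 'a set" where
  "fractions L R = {x \<otimes>\<^bsub>L\<^esub> inv\<^bsub>L\<^esub> y | x y. x \<in> R \<and> y \<in> R - {\<zero>\<^bsub>L\<^esub>}}"

definition fractional_ideal :: "('a, 'b) ring_scheme \<Rightarrow> 'a set \<Rightarrow> 'a set \<Rightarrow> bool" where
  "fractional_ideal L R J \<longleftrightarrow>
     subgroup J (add_monoid L) \<and>
     J \<subseteq> fractions L R \<and>
     (\<forall>r\<in>R. \<forall>x\<in>J. r \<otimes>\<^bsub>L\<^esub> x \<in> J) \<and>
     (\<exists>c\<in>R - {\<zero>\<^bsub>L\<^esub>}. \<forall>x\<in>J. c \<otimes>\<^bsub>L\<^esub> x \<in> R)"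

text \<open>
  The library constant \<^const>\<open>ideal_prod\<close> is applied here to subsets of \<open>L\<close> that need not be
  ideals of \<open>L\<close>: it is the set of nonempty finite sums of products of elements of \<open>I\<close> and \<open>J\<close>.
\<close>

definition invertible_ideal :: "('a, 'b) ring_scheme \<Rightarrow> 'a set \<Rightarrow> 'a set \<Rightarrow> bool" where
  "invertible_ideal L R I \<longleftrightarrow>
     fractional_ideal L R I \<and> (\<exists>J. fractional_ideal L R J \<and> ideal_prod L I J = R)"

lemma complex_ring_simps:
  "carrier complex_ring = UNIV" "x \<otimes>\<^bsub>complex_ring\<^esub> y = x * y" "x \<oplus>\<^bsub>complex_ring\<^esub> y = x + y"
  "\<one>\<^bsub>complex_ring\<^esub> = 1" "\<zero>\<^bsub>complex_ring\<^esub> = 0"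
  by (simp_all add: ring_of_type_algebra_def)

lemma complex_ring_a_inv: "\<ominus>\<^bsub>complex_ring\<^esub> x = - x"
proof -
  interpret field complex_ring by (rule field_from_type_algebra)
  show ?thesis
    by (rule minus_equality) (simp_all add: complex_ring_simps)
qed

lemma Z_sqrt_domain: "domain (Z_sqrt d)"
proof -
  interpret field complex_ring by (rule field_from_type_algebra)
  show ?thesis
    unfolding Z_sqrt_def
    by (intro subring_is_domain generate_ring_is_subring) (simp add: complex_ring_simps)
qed

lemma carrier_Z_sqrt:
  "carrier (Z_sqrt d) = {of_int a + of_int b * csqrt (of_int d) | a b. True}"
proof -
  let ?s = "csqrt (of_int d)"
  interpret field complex_ring by (rule field_from_type_algebra)
  have s2: "?s * ?s = of_int d"
    by (metis power2_csqrt power2_eq_square)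
  have "\<exists>a b. z = of_int a + of_int b * ?s" if "z \<in> generate_ring complex_ring {?s}" for z
    using that
  proof induction
    case one
    show ?case by (rule exI[of _ 1], rule exI[of _ 0]) (simp add: complex_ring_simps)
  next
    case (incl h)
    then show ?case by (intro exI[of _ 0] exI[of _ 1]) simp
  next
    case (a_inv h)
    then obtain a b where "h = of_int a + of_int b * ?s" by blast
    then show ?case
      by (intro exI[of _ "-a"] exI[of _ "-b"]) (simp add: complex_ring_a_inv)
  next
    case (eng_add h k)
    then obtain a b a' b' where "h = of_int a + of_int b * ?s" "k = of_int a' + of_int b' * ?s"
      by blast
    then show ?case
      by (intro exI[of _ "a + a'"] exI[of _ "b + b'"])
        (simp add: complex_ring_simps algebra_simps)
  next
    case (eng_mult h k)
    then obtain a b a' b' where hk: "h = of_int a + of_int b * ?s" "k = of_int a' + of_int b' * ?s"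
      by blast
    have "h * k = of_int a * of_int a' + of_int b * of_int b' * (?s * ?s) +
        (of_int a * of_int b' + of_int b * of_int a') * ?s"
      by (simp add: hk algebra_simps)
    then show ?case
      by (intro exI[of _ "a * a' + b * b' * d"] exI[of _ "a * b' + b * a'"])
        (simp add: complex_ring_simps s2)
  qed
  moreover have int_mem: "of_int a \<in> generate_ring complex_ring {?s}" for a
  proof (induction a rule: int_induct[where k = 0])
    case base
    show ?case using ring.zero_in_generate[OF ring_axioms] by (simp add: complex_ring_simps)
  next
    case (step1 i)
    then show ?case
      using generate_ring.eng_add[OF step1(2) generate_ring.one] by (simp add: complex_ring_simps)
  next
    case (step2 i)
    then show ?case
      using generate_ring.eng_add[OF step2(2) generate_ring.a_inv[OF generate_ring.one]]
      by (simp add: complex_ring_simps complex_ring_a_inv)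
  qed
  moreover have "of_int a + of_int b * ?s \<in> generate_ring complex_ring {?s}" for a b
    using generate_ring.eng_add[OF int_mem
        generate_ring.eng_mult[OF int_mem generate_ring.incl[OF singletonI]]]
    by (simp add: complex_ring_simps)
  ultimately show ?thesis
    unfolding Z_sqrt_def by auto
qed

end

theory Submission
  imports Defs
begin

text \<open>
  Divide \<open>I\<close> by an element of minimal absolute value. The resulting lattice \<open>L\<close> contains \<open>O\<close>, and
  its nonzero elements have absolute value at least 1, so an element of \<open>L\<close> at distance less than 1
  from \<open>O\<close> lies in \<open>O\<close>. For each \<open>z \<in> L\<close> this applies to one of \<open>z\<close>, \<open>2z\<close>, \<open>3z\<close>, which leads to
  \<open>z \<in> O \<union> (\<omega> + O)\<close> with \<open>\<omega> = (1 + \<surd>d) / 2\<close>, so \<open>L\<close> is \<open>O\<close> or \<open>O[\<omega>]\<close>. The latter is impossible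
  for invertible \<open>I\<close>: if \<open>I\<close> is stable under \<open>\<omega>\<close>, then so is \<open>IJ = O\<close>.
\<close>

lemma csqrt_of_int_neg:
  assumes "d < (0::int)"
  shows "Re (csqrt (of_int d)) = 0" "(Im (csqrt (of_int d)))\<^sup>2 = - of_int d"
    "Im (csqrt (of_int d)) \<noteq> 0" "csqrt (of_int d) * csqrt (of_int d) = of_int d"
proof -
  have *: "csqrt (of_int d) = \<i> * sqrt (- of_int d)"
    using csqrt_of_real_nonpos[of "of_int d"] assms by (simp add: abs_if)
  show "Re (csqrt (of_int d)) = 0" "(Im (csqrt (of_int d)))\<^sup>2 = - of_int d"
    "Im (csqrt (of_int d)) \<noteq> 0"
    using assms by (auto simp: *)
  show "csqrt (of_int d) * csqrt (of_int d) = of_int d"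
    by (metis power2_csqrt power2_eq_square)
qed

section \<open>Lattices over the order without short nonzero vectors\<close>

text \<open>These are the properties of an ideal after division by a nonzero element of minimal
  absolute value; the main proof takes \<open>{z. z * a \<in> I}\<close> for
  \<open>L\<close>.\<close>

locale reduced_lattice =
  fixes d :: int and L :: "complex set"
  assumes d: "d = -3 \<or> d = -7"
    and one_mem: "1 \<in> L"
    and diff_mem: "\<And>x y. x \<in> L \<Longrightarrow> y \<in> L \<Longrightarrow> x - y \<in> L"
    and scale_mem: "\<And>x y. x \<in> carrier (Z_sqrt d) \<Longrightarrow> y \<in> L \<Longrightarrow> x * y \<in> L"
    and one_le_cmod: "\<And>x. x \<in> L \<Longrightarrow> x \<noteq> 0 \<Longrightarrow> 1 \<le> cmod x"
begin

definition "s = csqrt (of_int d)"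

lemma s: "Re s = 0" "(Im s)\<^sup>2 = - of_int d" "Im s \<noteq> 0" "s * s = of_int d"
  using csqrt_of_int_neg[of d] d unfolding s_def by auto

lemma order_mem: "of_int a + of_int b * s \<in> carrier (Z_sqrt d)"
  unfolding carrier_Z_sqrt s_def by blast

lemma orderE:
  assumes "x \<in> carrier (Z_sqrt d)"
  obtains a b :: int where "x = of_int a + of_int b * s"
  using assms unfolding carrier_Z_sqrt s_def by blast

lemma shift_mem: "z \<in> L \<Longrightarrow> z - (of_int a + of_int b * s) \<in> L"
  using diff_mem scale_mem[OF order_mem one_mem] by simp

lemma eq_order_element:
  assumes "z \<in> L" and "cmod (z - (of_int a + of_int b * s)) < 1"
  shows "z = of_int a + of_int b * s"
  using one_le_cmod[OF shift_mem[OF assms(1), of a b]] assms(2) by force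

text \<open>As \<open>s\<close> is purely imaginary, \<open>Im z / Im s\<close> is the coordinate of
  \<open>z\<close> along \<open>s\<close>; rows of the order sit at its integer values.\<close>

lemma cmod_sq: "(cmod (z - (of_int a + of_int b * s)))\<^sup>2 =
    (Re z - of_int a)\<^sup>2 - of_int d * (Im z / Im s - of_int b)\<^sup>2"
proof -
  have "(cmod (z - (of_int a + of_int b * s)))\<^sup>2 = (Re z - of_int a)\<^sup>2 + (Im z - of_int b * Im s)\<^sup>2"
    using s(1) by (simp add: cmod_power2)
  also have "Im z - of_int b * Im s = Im s * (Im z / Im s - of_int b)"
    using s(3) by (simp add: right_diff_distrib)
  finally show ?thesis by (simp only: power_mult_distrib s(2) mult_minus_left diff_conv_add_uminus)
qed

text \<open>
  Every point at vertical distance less than \<open>\<surd>3 / 2\<close> from a row of \<open>O\<close> is at distance less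
  than 1 from a point in that row.
\<close>
lemma order_if_close_row:
  assumes "z \<in> L" and "- of_int d * (Im z / Im s - of_int n)\<^sup>2 < 3 / 4"
  shows "z \<in> carrier (Z_sqrt d)"
proof -
  let ?m = "round (Re z)"
  have "\<bar>Re z - of_int ?m\<bar> \<le> 1 / 2"
    using of_int_round_abs_le[of "Re z"] by (simp add: abs_minus_commute)
  then have "(Re z - of_int ?m)\<^sup>2 \<le> (1 / 2)\<^sup>2"
    by (metis abs_le_square_iff abs_of_nonneg divide_nonneg_nonneg zero_le_one zero_le_numeral)
  then have "(cmod (z - (of_int ?m + of_int n * s)))\<^sup>2 < 1\<^sup>2"
    unfolding cmod_sq using assms(2) by (simp add: power_divide)
  then have "cmod (z - (of_int ?m + of_int n * s)) < 1"
    using power_less_imp_less_base zero_le_one by blast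
  from eq_order_element[OF assms(1) this] show ?thesis by (metis order_mem)
qed

section \<open>Elements whose double or triple lies in the order\<close>

lemma half_not_mem: "1 / 2 \<notin> L"
  using one_le_cmod[of "1 / 2"] by auto

text \<open>Multiplying by \<open>s\<close> gives \<open>d / 2\<close>, which differs from
  \<open>1 / 2\<close> by an integer because \<open>d\<close> is odd.\<close>

lemma half_s_not_mem: "s / 2 \<notin> L"
proof
  assume "s / 2 \<in> L"
  from scale_mem[OF order_mem[of 0 1] this] have "of_int d / 2 \<in> L"
    by (simp add: s(4))
  moreover obtain k where "d = 2 * k + 1" using d by (auto intro: that[of "-2"] that[of "-4"])
  ultimately show False
    using shift_mem[of "of_int d / 2" k 0] half_not_mem by (simp add: add_divide_distrib)
qed

text \<open>Modulo the order, \<open>z\<close> is 0, \<open>1 / 2\<close>, \<open>s / 2\<close> or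
  \<open>(1 + s) / 2\<close>, and the two middle classes do not meet \<open>L\<close>.\<close>

lemma double_mem_order:
  assumes z: "z \<in> L" and "2 * z \<in> carrier (Z_sqrt d)"
  shows "z \<in> carrier (Z_sqrt d) \<or> z - (1 + s) / 2 \<in> carrier (Z_sqrt d)"
proof -
  obtain a b where ab: "2 * z = of_int a + of_int b * s" using assms(2) by (rule orderE)
  define m n i j where mn: "m = a div 2" "n = b div 2" and ij: "i = a mod 2" "j = b mod 2"
  have a: "a = 2 * m + i" and b: "b = 2 * n + j" by (simp_all add: mn ij)
  have w: "z - (of_int m + of_int n * s) = (of_int i + of_int j * s) / 2"
    using ab by (simp add: a b field_simps)
  then have L: "(of_int i + of_int j * s) / 2 \<in> L" using shift_mem[OF z] by metis
  have "i = 0 \<or> i = 1" "j = 0 \<or> j = 1" unfolding ij by auto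
  then consider "i = 0" "j = 0" | "i = 1" "j = 1" using L half_not_mem half_s_not_mem by auto
  then show ?thesis
  proof cases
    case 1
    then have "z = of_int m + of_int n * s" using w by simp
    then show ?thesis using order_mem by simp
  next
    case 2
    then have "z - (1 + s) / 2 = of_int m + of_int n * s" using w by (simp add: 2 diff_eq_eq ac_simps del: divide_eq_eq_numeral1 eq_divide_eq_numeral1)
    then show ?thesis using order_mem by simp
  qed
qed

text \<open>Rounding both coordinates leaves errors of at most 1/3, so the squared distance to the
  order is at most (1 + 7) / 9 < 1.\<close>

lemma triple_mem_order:
  assumes d7: "d = -7" and z: "z \<in> L" and "3 * z \<in> carrier (Z_sqrt d)"
  shows "z \<in> carrier (Z_sqrt d)"
proof -
  obtain a b where ab: "3 * z = of_int a + of_int b * s" using assms(3) by (rule orderE)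
  \<comment> \<open>The shift by 1 rounds \<open>a / 3\<close> and \<open>b / 3\<close> to the
    nearest integer, so the remainders lie in {-1, 0, 1}.\<close>
  define m n where mn: "m = (a + 1) div 3" "n = (b + 1) div 3"
  define i j where ij: "i = a - 3 * m" "j = b - 3 * n"
  have "i = -1 \<or> i = 0 \<or> i = 1" "j = -1 \<or> j = 0 \<or> j = 1" unfolding ij mn by presburger+
  then have "i\<^sup>2 \<le> 1" "j\<^sup>2 \<le> 1" by auto
  then have ij_le: "real_of_int i ^ 2 \<le> 1" "real_of_int j ^ 2 \<le> 1"
    by (metis of_int_1 of_int_le_iff of_int_power)+
  have zeq: "z = (of_int a + of_int b * s) / 3" using ab by (simp add: field_simps)
  have "Re z = of_int a / 3" "Im z / Im s = of_int b / 3" using s(1,3) by (simp_all add: zeq)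
  then have e: "Re z - of_int m = of_int i / 3" "Im z / Im s - of_int n = of_int j / 3"
    by (simp_all add: ij)
  have "(cmod (z - (of_int m + of_int n * s)))\<^sup>2 < 1\<^sup>2"
    unfolding cmod_sq e using ij_le d7 by (simp add: power_divide)
  then have "cmod (z - (of_int m + of_int n * s)) < 1"
    using power_less_imp_less_base zero_le_one by blast
  from eq_order_element[OF z this] show ?thesis using order_mem by simp
qed

lemma nat_scale_mem: "z \<in> L \<Longrightarrow> of_nat k * z \<in> L"
  using scale_mem[OF order_mem[of "int k" 0], of z] by simp

text \<open>With \<open>t\<close> the fractional height of \<open>z\<close> between two rows, some
  \<open>k * z\<close> with \<open>k\<close> at most 3 is close enough to a row to lie in the
  order.\<close>

lemma order_or_maximal_order:
  assumes z: "z \<in> L"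
  shows "z \<in> carrier (Z_sqrt d) \<or> z - (1 + s) / 2 \<in> carrier (Z_sqrt d)"
proof -
  let ?v = "Im z / Im s"
  have L2: "2 * z \<in> L" and L3: "3 * z \<in> L"
    using nat_scale_mem[OF z, of 2] nat_scale_mem[OF z, of 3] by simp_all
  define n where "n = floor ?v"
  define t where "t = ?v - of_int n"
  have t: "0 \<le> t" "t < 1" unfolding t_def n_def by linarith+
  have v: "?v = of_int n + t" "Im (2 * z) / Im s = of_int (2 * n) + 2 * t"
      "Im (3 * z) / Im s = of_int (3 * n) + 3 * t"
    by (simp_all add: t_def algebra_simps)
  have bound: "x\<^sup>2 < c\<^sup>2" if "\<bar>x\<bar> < c" for x c :: real
    using that abs_square_less_1 power_strict_mono[of "\<bar>x\<bar>" c 2] by simp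
  have row: "x \<in> carrier (Z_sqrt d)" if "x \<in> L" "\<bar>Im x / Im s - of_int k\<bar> < c"
      "- of_int d * c\<^sup>2 \<le> 3 / 4" for x k and c :: real
  proof (rule order_if_close_row[OF that(1), of k])
    have "- of_int d * (Im x / Im s - of_int k)\<^sup>2 < - of_int d * c\<^sup>2"
      using bound[OF that(2)] d by auto
    then show "- of_int d * (Im x / Im s - of_int k)\<^sup>2 < 3 / 4" using that(3) by linarith
  qed
  show ?thesis
  proof (cases "d = -3")
    case True
    \<comment> \<open>Strips of half-width 1/2 around the rows are admissible since 3 * (1/2)^2 =
      3/4. They are open and miss only \<open>t = 1 / 2\<close>, where \<open>2 * z\<close> lies on
      a row.\<close>
    consider "t < 1 / 2" | "t > 1 / 2" | "t = 1 / 2" by linarith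
    then show ?thesis
    proof cases
      case 1
      then show ?thesis
        using row[OF z, of n "1 / 2", unfolded v(1)] t True by (simp add: power2_eq_square)
    next
      case 2
      then show ?thesis
        using row[OF z, of "n + 1" "1 / 2", unfolded v(1)] t True by (simp add: power2_eq_square)
    next
      case 3
      then show ?thesis
        using row[OF L2, of "2 * n + 1" "1 / 2", unfolded v(2)] double_mem_order[OF z] True
        by (simp add: power2_eq_square)
    qed
  next
    case False
    then have d7: "d = -7" using d by simp
    \<comment> \<open>With half-width 3/10, the strips around heights 0, 1/3, 1/2, 2/3 and 1, scaled
      down by 1, 3, 2, 3 and 1, overlap and cover all \<open>t\<close>.\<close>
    have c: "- of_int d * (3 / 10 :: real)\<^sup>2 \<le> 3 / 4" by (simp add: d7 power2_eq_square)
    consider "t < 3 / 10" | "3 / 10 \<le> t" "t < 2 / 5" | "2 / 5 \<le> t" "t < 3 / 5"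
      | "3 / 5 \<le> t" "t < 3 / 4" | "3 / 4 \<le> t" by linarith
    then show ?thesis
    proof cases
      case 1
      then show ?thesis using row[OF z, of n, unfolded v(1), OF _ c] t by simp
    next
      case 2
      then have "\<bar>3 * t - 1\<bar> < 3 / 10" by linarith
      then show ?thesis
        using row[OF L3, of "3 * n + 1", unfolded v(3), OF _ c] triple_mem_order[OF d7 z] by simp
    next
      case 3
      then have "\<bar>2 * t - 1\<bar> < 3 / 10" by linarith
      then show ?thesis
        using row[OF L2, of "2 * n + 1", unfolded v(2), OF _ c] double_mem_order[OF z] by simp
    next
      case 4
      then have "\<bar>3 * t - 2\<bar> < 3 / 10" by linarith
      then show ?thesis
        using row[OF L3, of "3 * n + 2", unfolded v(3), OF _ c] triple_mem_order[OF d7 z] by simp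
    next
      case 5
      then have "\<bar>t - 1\<bar> < 3 / 10" using t by linarith
      then show ?thesis using row[OF z, of "n + 1", unfolded v(1), OF _ c] by simp
    qed
  qed
qed

text \<open>An element of \<open>L\<close> outside the order lies in \<omega> plus the order, so
  \<omega> is in \<open>L\<close>. Since \<omega>^2 = \<omega> + k for d = 4k + 1, multiplication by
  \<omega> keeps both possible cosets inside \<open>L\<close>.\<close>

lemma eq_order_or_omega_closed:
  "L = carrier (Z_sqrt d) \<or> (\<forall>z\<in>L. (1 + s) / 2 * z \<in> L)"
proof (cases "L \<subseteq> carrier (Z_sqrt d)")
  case True
  then show ?thesis using scale_mem[OF _ one_mem] by auto
next
  case False
  let ?w = "(1 + s) / 2"
  have sum_mem: "x + y \<in> L" if "x \<in> L" "y \<in> L" for x y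
    using diff_mem[OF that(1) diff_mem[OF diff_mem[OF that(2) that(2)] that(2)]] by simp
  obtain z where z: "z \<in> L" "z \<notin> carrier (Z_sqrt d)" using False by blast
  then obtain a b where "z - ?w = of_int a + of_int b * s"
    using order_or_maximal_order orderE by metis
  then have "?w = z - (of_int a + of_int b * s)" by (simp add: algebra_simps)
  then have w: "?w \<in> L" using shift_mem[OF z(1)] by metis
  have wsq: "?w * ?w \<in> L"
  proof -
    obtain k where k: "d = 4 * k + 1" using d by (auto intro: that[of "-1"] that[of "-2"])
    have "?w * ?w = ?w - (of_int (- k) + of_int 0 * s)"
      using s(4) k by (simp add: field_simps)
    then show ?thesis using shift_mem[OF w] by metis
  qed
  have "?w * x \<in> L" if "x \<in> L" for x
    using order_or_maximal_order[OF that]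
  proof
    assume "x \<in> carrier (Z_sqrt d)"
    from scale_mem[OF this w] show ?thesis by (simp add: mult.commute)
  next
    assume "x - ?w \<in> carrier (Z_sqrt d)"
    from sum_mem[OF scale_mem[OF this w] wsq] show ?thesis by (simp add: algebra_simps)
  qed
  then show ?thesis by blast
qed

end

section \<open>Invertible ideals are not stable under \<omega>\<close>

lemma omega_not_mem:
  assumes "d < 0"
  shows "(1 + csqrt (of_int d)) / 2 \<notin> carrier (Z_sqrt d)"
proof
  assume "(1 + csqrt (of_int d)) / 2 \<in> carrier (Z_sqrt d)"
  then obtain a b where "(1 + csqrt (of_int d)) / 2 = of_int a + of_int b * csqrt (of_int d)"
    unfolding carrier_Z_sqrt by blast
  then have "Re ((1 + csqrt (of_int d)) / 2) = Re (of_int a + of_int b * csqrt (of_int d))" by simp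
  then have "1 = 2 * real_of_int a"
    using csqrt_of_int_neg(1)[OF assms] by simp
  then have "1 = 2 * a" by linarith
  then show False by presburger
qed

text \<open>The factor \<open>w\<close> is absorbed by the left factor of each product and
  distributes over sums.\<close>

lemma ideal_prod_complex_closed:
  assumes "\<And>x. x \<in> I \<Longrightarrow> w * x \<in> I" and "x \<in> ideal_prod complex_ring I J"
  shows "w * x \<in> ideal_prod complex_ring I J"
  using assms(2)
proof induction
  case (prod i j)
  then show ?case
    using ideal_prod.prod[OF assms(1)[OF prod(1)] prod(2), of complex_ring]
    by (simp add: complex_ring_simps mult.assoc)
next
  case (sum x y)
  then show ?case
    using ideal_prod.sum[OF sum.IH] by (simp add: complex_ring_simps distrib_left)
qed

text \<open>Otherwise the product of \<open>I\<close> with its inverse, which is the order, would be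
  stable under \<omega>; containing 1, it would contain \<omega>.\<close>

lemma not_omega_closed:
  assumes "d < 0" and "invertible_ideal complex_ring (carrier (Z_sqrt d)) I"
  shows "\<exists>x\<in>I. (1 + csqrt (of_int d)) / 2 * x \<notin> I"
proof (rule ccontr)
  assume "\<not> ?thesis"
  moreover obtain J where J: "ideal_prod complex_ring I J = carrier (Z_sqrt d)"
    using assms(2) unfolding invertible_ideal_def by blast
  moreover have "1 \<in> carrier (Z_sqrt d)"
    unfolding carrier_Z_sqrt by (auto intro: exI[of _ 1] exI[of _ 0])
  ultimately have "(1 + csqrt (of_int d)) / 2 * 1 \<in> carrier (Z_sqrt d)"
    using ideal_prod_complex_closed[of I _ 1 J] by metis
  then show False using omega_not_mem[OF assms(1)] by simp
qed

section \<open>Elements of minimal absolute value\<close>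

text \<open>Squared absolute values on the order are the natural numbers
  \<open>a\<^sup>2 - d * b\<^sup>2\<close>, so a least one is attained.\<close>

lemma exists_min_cmod:
  assumes "d < 0" and "I \<subseteq> carrier (Z_sqrt d)" and "x \<in> I" "x \<noteq> 0"
  obtains a where "a \<in> I" "a \<noteq> 0" "\<And>y. y \<in> I \<Longrightarrow> y \<noteq> 0 \<Longrightarrow> cmod a \<le> cmod y"
proof -
  have nat: "(cmod y)\<^sup>2 \<in> \<nat>" if "y \<in> I" for y
  proof -
    obtain a b where y: "y = of_int a + of_int b * csqrt (of_int d)"
      using assms(2) \<open>y \<in> I\<close> unfolding carrier_Z_sqrt by blast
    have "(cmod y)\<^sup>2 = of_int (a\<^sup>2 - d * b\<^sup>2)"
      using csqrt_of_int_neg[OF assms(1)] by (simp add: y cmod_power2 power_mult_distrib)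
    moreover have "0 \<le> a\<^sup>2 - d * b\<^sup>2"
      using assms(1) by (smt (verit) mult_nonpos_nonneg zero_le_power2)
    ultimately show ?thesis by (metis of_nat_nat of_nat_in_Nats of_int_of_nat_eq)
  qed
  obtain a where a: "a \<in> I \<and> a \<noteq> 0"
    "\<And>y. y \<in> I \<and> y \<noteq> 0 \<Longrightarrow> nat \<lfloor>(cmod a)\<^sup>2\<rfloor> \<le> nat \<lfloor>(cmod y)\<^sup>2\<rfloor>"
    using ex_has_least_nat[of "\<lambda>y. y \<in> I \<and> y \<noteq> 0" x "\<lambda>y. nat \<lfloor>(cmod y)\<^sup>2\<rfloor>"] assms(3,4) by auto
  show ?thesis
  proof
    show "a \<in> I" "a \<noteq> 0" using a by auto
    fix y assume y: "y \<in> I" "y \<noteq> 0"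
    obtain k l where "(cmod a)\<^sup>2 = of_nat k" "(cmod y)\<^sup>2 = of_nat l"
      using nat a(1) y(1) by (meson Nats_cases)
    then have "(cmod a)\<^sup>2 \<le> (cmod y)\<^sup>2" using a(2)[of y] y by simp
    then show "cmod a \<le> cmod y" by (simp add: power2_le_iff_abs_le)
  qed
qed

section \<open>From the lattice back to the ideal\<close>

theorem proposition4p6:
  fixes d :: int and I :: "complex set"
  assumes "d = -3 \<or> d = -7"
    and "ideal I (Z_sqrt d)"
    and "invertible_ideal complex_ring (carrier (Z_sqrt d)) I"
  shows "principalideal I (Z_sqrt d)"
proof -
  interpret R: domain "Z_sqrt d" by (rule Z_sqrt_domain)
  interpret I: ideal I "Z_sqrt d" by (rule assms(2))
  have neg: "d < 0" using assms(1) by auto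
  have ops: "x \<otimes>\<^bsub>Z_sqrt d\<^esub> y = x * y" "x \<oplus>\<^bsub>Z_sqrt d\<^esub> y = x + y" "\<zero>\<^bsub>Z_sqrt d\<^esub> = 0" for x y
    by (simp_all add: Z_sqrt_def complex_ring_simps)
  have subset: "I \<subseteq> carrier (Z_sqrt d)" using I.a_subset .
  have scale: "r * x \<in> I" if "r \<in> carrier (Z_sqrt d)" "x \<in> I" for r x
    using I.I_l_closed[OF that(2,1)] by (simp add: ops)
  have sub: "x - y \<in> I" if "x \<in> I" "y \<in> I" for x y
  proof -
    have "- 1 \<in> carrier (Z_sqrt d)"
      unfolding carrier_Z_sqrt by (auto intro: exI[of _ "-1"] exI[of _ 0])
    then show ?thesis
      using I.a_closed[OF that(1) scale[of "- 1" y]] that(2) by (simp add: ops)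
  qed
  \<comment> \<open>The zero ideal is stable under \<omega>, hence not invertible.\<close>
  obtain x where "x \<in> I" "x \<noteq> 0"
    using not_omega_closed[OF neg assms(3)] I.zero_closed by (metis mult_zero_right ops(3))
  then obtain a where a: "a \<in> I" "a \<noteq> 0" "\<And>y. y \<in> I \<Longrightarrow> y \<noteq> 0 \<Longrightarrow> cmod a \<le> cmod y"
    using exists_min_cmod[OF neg subset] by blast
  interpret reduced_lattice d "{z. z * a \<in> I}"
  proof
    show "d = -3 \<or> d = -7" by fact
    show "1 \<in> {z. z * a \<in> I}" using a(1) by simp
    show "x - y \<in> {z. z * a \<in> I}" if "x \<in> {z. z * a \<in> I}" "y \<in> {z. z * a \<in> I}" for x y
      using that sub by (simp add: left_diff_distrib)
    show "x * y \<in> {z. z * a \<in> I}" if "x \<in> carrier (Z_sqrt d)" "y \<in> {z. z * a \<in> I}" for x y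
      using that scale by (simp add: mult.assoc)
    show "1 \<le> cmod x" if "x \<in> {z. z * a \<in> I}" "x \<noteq> 0" for x
      using that a(3)[of "x * a"] a(2) by (simp add: norm_mult)
  qed
  have *: "{z. z * a \<in> I} = carrier (Z_sqrt d)"
  proof (rule ccontr)
    assume "{z. z * a \<in> I} \<noteq> carrier (Z_sqrt d)"
    then have *: "(1 + s) / 2 * z * a \<in> I" if "z * a \<in> I" for z
      using eq_order_or_omega_closed that by blast
    \<comment> \<open>Stability of the lattice under \<omega> carries over to \<open>I\<close>, as
      \<open>x / a\<close> lies in the lattice.\<close>
    have "(1 + s) / 2 * x \<in> I" if "x \<in> I" for x
      using *[of "x / a"] that a(2) by simp
    then show False using not_omega_closed[OF neg assms(3)] a(2) by (auto simp: s_def)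
  qed
  have "I = {z * a | z. z \<in> carrier (Z_sqrt d)}"
  proof (intro Set.set_eqI iffI)
    fix x assume "x \<in> I"
    then have "x / a \<in> carrier (Z_sqrt d)" using a(2) unfolding *[symmetric] by simp
    then show "x \<in> {z * a | z. z \<in> carrier (Z_sqrt d)}"
      by (intro CollectI exI[of _ "x / a"]) (simp add: a(2))
  qed (use * in blast)
  then have "I = PIdl\<^bsub>Z_sqrt d\<^esub> a" unfolding cgenideal_def ops .
  then show ?thesis using R.cgenideal_is_principalideal[of a] a(1) subset by (metis subsetD)
qed

end
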